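(* Let $\mathbf{F}$ be a field of characteristic $2$. There are forms $a,b,c,d$ on $\mathfrak{sl}_4(\mathbf{F})$ (evaluated at pairs of elements) such that for any $x,y\in\mathfrak{sl}_4(\mathbf{F})$ the following identity holds in $\mathfrak{psl}_4(\mathbf{F})$: $$[x,y,y,y] = a(x,y)\,x + b(x,y)\,y + c(x,y)\,[x,y] + d(x,y)\,y^2.$$
   Context: $\mathfrak{sl}_4(\mathbf{F})$ is the Lie algebra of traceless $4\times4$ matrices over $\mathbf{F}$ with bracket $[x,y]=xy-yx$, and $\mathfrak{psl}_4(\mathbf{F})$ is its quotient by the central ideal of scalar multiples of the identity. Brackets are left-normed: $[x,y,y,y]=[[[x,y],y],y]$. Here $y^2$ is the matrix square, which is traceless in characteristic $2$ when $y$ is. A form here is an $\mathbf{F}$-valued function of $(x,y)$ given by a homogeneous polynomial with coefficients in $\mathbf{F}$ in the entries of the matrices $x$ and $y$. That the identity holds in $\mathfrak{psl}_4(\mathbf{F})$ means that the two sides, computed with the matrices $x,y$, are equal modulo scalar matrices. *)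

theory Defs
  imports "HOL-Analysis.Analysis" "HOL-Library.Poly_Mapping"
begin

definition sl4 :: "('f::field ^ 4 ^ 4) set" where
  "sl4 = {x. trace x = 0}"

definition lie_bracket :: "'f::field ^ 4 ^ 4 \<Rightarrow> 'f ^ 4 ^ 4 \<Rightarrow> 'f ^ 4 ^ 4" where
  "lie_bracket x y = x ** y - y ** x"

(* The operation *s of the library scales vectors; on a matrix it would need matrix entries to be
   multiplied by rows, so scaling of matrices is introduced separately. *)
definition smult_matrix :: "'f::field \<Rightarrow> 'f ^ 4 ^ 4 \<Rightarrow> 'f ^ 4 ^ 4" where
  "smult_matrix c x = (\<chi> i j. c * x $ i $ j)"

(* The coset of u modulo the scalar matrices, i.e. the image of u in psl4.  In characteristic 2
   the scalar matrices are traceless, so the coset of an element of sl4 lies inside sl4. *)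
definition psl4_class :: "'f::field ^ 4 ^ 4 \<Rightarrow> ('f ^ 4 ^ 4) set" where
  "psl4_class u = {u + mat c | c. True}"

(* Multivariate polynomials with variables in 'v: a monomial is a finitely supported exponent
   function, a polynomial a finitely supported assignment of coefficients to monomials. *)
type_synonym ('v, 'f) mpolynomial = "('v \<Rightarrow>\<^sub>0 nat) \<Rightarrow>\<^sub>0 'f"

definition eval_mpolynomial :: "('v \<Rightarrow> 'f::field) \<Rightarrow> ('v, 'f) mpolynomial \<Rightarrow> 'f" where
  "eval_mpolynomial s p =
     (\<Sum>m\<in>Poly_Mapping.keys p.
        Poly_Mapping.lookup p m * (\<Prod>v\<in>Poly_Mapping.keys m. s v ^ Poly_Mapping.lookup m v))"

definition homogeneous_of_degree :: "nat \<Rightarrow> ('v, 'f::field) mpolynomial \<Rightarrow> bool" where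
  "homogeneous_of_degree n p \<longleftrightarrow>
     (\<forall>m\<in>Poly_Mapping.keys p. (\<Sum>v\<in>Poly_Mapping.keys m. Poly_Mapping.lookup m v) = n)"

(* The variable Inl (i, j) stands for the entry (i, j) of x, and Inr (i, j) for that of y. *)
definition pair_entries :: "'f::field ^ 4 ^ 4 \<Rightarrow> 'f ^ 4 ^ 4 \<Rightarrow> (4 \<times> 4) + (4 \<times> 4) \<Rightarrow> 'f" where
  "pair_entries x y = case_sum (\<lambda>(i, j). x $ i $ j) (\<lambda>(i, j). y $ i $ j)"

definition form_on_sl4 :: "('f::field ^ 4 ^ 4 \<Rightarrow> 'f ^ 4 ^ 4 \<Rightarrow> 'f) \<Rightarrow> bool" where
  "form_on_sl4 f \<longleftrightarrow>
     (\<exists>n p. homogeneous_of_degree n p \<and>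
        (\<forall>x\<in>sl4. \<forall>y\<in>sl4. f x y = eval_mpolynomial (pair_entries x y) p))"

lemma psl4_class_eq_iff: "psl4_class u = psl4_class v \<longleftrightarrow> (\<exists>c. u - v = mat c)"
proof
  assume eq: "psl4_class u = psl4_class v"
  have "u + mat 0 \<in> psl4_class u" unfolding psl4_class_def by blast
  then obtain c where "u + mat 0 = v + mat c"
    unfolding eq by (auto simp: psl4_class_def)
  then show "\<exists>c. u - v = mat c" by (intro exI[of _ c]) (simp add: algebra_simps)
next
  assume "\<exists>c. u - v = mat c"
  then obtain c where c: "u = v + mat c" by (metis add.commute diff_add_cancel)
  have add: "mat a + mat b = (mat (a + b) :: 'a ^ 4 ^ 4)" for a b
    by (simp add: mat_def vec_eq_iff)
  have "u + mat a = v + mat (c + a)" "v + mat a = u + mat (a - c)" for a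
    unfolding c by (simp_all add: add add.assoc)
  then show "psl4_class u = psl4_class v" unfolding psl4_class_def by blast
qed

lemma lie_bracket_in_sl4: "lie_bracket x y \<in> sl4"
  unfolding sl4_def lie_bracket_def mem_Collect_eq trace_sub
  by (simp add: trace_mul_sym[of x y])

lemma square_in_sl4:
  fixes y :: "'f::field ^ 4 ^ 4"
  assumes char2: "CHAR('f) = 2" and y: "y \<in> sl4"
  shows "y ** y \<in> sl4"
proof -
  have two: "(2::'f) = 0" using of_nat_CHAR[where ?'a='f] unfolding char2 by simp
  have tr: "y$1$1 + y$2$2 + y$3$3 + y$4$4 = 0"
    using y by (simp add: sl4_def trace_def sum_4)
  have "trace (y ** y) = (y$1$1 + y$2$2 + y$3$3 + y$4$4)^2 +
     2 * (y$1$2 * y$2$1 + y$1$3 * y$3$1 + y$1$4 * y$4$1 + y$2$3 * y$3$2 + y$2$4 * y$4$2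
        + y$3$4 * y$4$3 - y$1$1 * y$2$2 - y$1$1 * y$3$3 - y$1$1 * y$4$4 - y$2$2 * y$3$3
        - y$2$2 * y$4$4 - y$3$3 * y$4$4)"
    by (simp add: trace_def matrix_matrix_mult_def sum_4 power2_eq_square algebra_simps)
  also have "\<dots> = 0" unfolding tr two by simp
  finally show ?thesis by (simp add: sl4_def)
qed

end

theory Submission
  imports Defs "HOL-Computational_Algebra.Polynomial"
begin

text \<open>
  The identity is the polarised Cayley--Hamilton theorem. Let \<open>e\<^sub>2\<close>, \<open>e\<^sub>3\<close>, \<open>e\<^sub>4\<close> be the sums of the
  principal minors of order 2, 3, 4. A \<open>4 \<times> 4\<close> matrix \<open>Y\<close> over any commutative ring satisfies
  \<open>Y\<^sup>4 - tr(Y) Y\<^sup>3 + e\<^sub>2(Y) Y\<^sup>2 - e\<^sub>3(Y) Y = - e\<^sub>4(Y) I\<close>. Apply this to the pencil \<open>Y = y + t x\<close> over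
  \<open>F[t]\<close> and compare the coefficients of \<open>t\<close>. When \<open>x\<close> and \<open>y\<close> are traceless, every term with a
  trace disappears, and the result is that
  \<open>x y\<^sup>3 + y x y\<^sup>2 + y\<^sup>2 x y + y\<^sup>3 x + e\<^sub>2(y) (x y + y x) + e\<^sub>2'(x, y) y\<^sup>2 - e\<^sub>3(y) x - e\<^sub>3'(x, y) y\<close>
  is a scalar matrix, where \<open>e\<^sub>k'(x, y)\<close> is the coefficient of \<open>t\<close> in \<open>e\<^sub>k(y + t x)\<close>.

  In characteristic 2 the bracket \<open>[u, v]\<close> is \<open>u v + v u\<close>, and the binomial coefficients 1, 3, 3, 1
  in the expansion of \<open>[x, y, y, y]\<close> are all odd, so \<open>[x, y, y, y]\<close> is the sum of the first four terms.
  Hence \<open>a = e\<^sub>3(y)\<close>, \<open>b = e\<^sub>3'(x, y)\<close>, \<open>c = e\<^sub>2(y)\<close>, \<open>d = e\<^sub>2'(x, y)\<close> solve the problem, because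
  \<open>-u = u\<close>. Only the class modulo scalar matrices matters, so the Cayley--Hamilton theorem takes the
  form that the left-hand side of the equation for \<open>Y\<close> (\<open>char_poly_nonconstant\<close>) is a scalar matrix:
  this is \<open>cayley_hamilton_4\<close>, and its coefficient of \<open>t\<close> is \<open>polarised_cayley_hamilton\<close>.
\<close>

section \<open>Evaluation and homogeneity of multivariate polynomials\<close>

lemma eval_mpolynomial_add:
  "eval_mpolynomial s (p + q) = eval_mpolynomial s p + eval_mpolynomial s q"
  unfolding eval_mpolynomial_def
  by (rule setsum_keys_plus_distrib) (simp_all add: algebra_simps)

lemma eval_mpolynomial_uminus: "eval_mpolynomial s (- p) = - eval_mpolynomial s p"
  by (simp add: eval_mpolynomial_def sum_negf)

lemma eval_mpolynomial_single:
  "eval_mpolynomial s (Poly_Mapping.single m c) =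
     c * (\<Prod>v\<in>Poly_Mapping.keys m. s v ^ Poly_Mapping.lookup m v)"
  by (simp add: eval_mpolynomial_def)

text \<open>The product over the keys of a monomial does not change when extended over a larger set of
  variables, so both factors and their product can be compared on the union of the keys.\<close>

lemma monomial_value_add:
  fixes s :: "'v \<Rightarrow> 'f::field" and m n :: "'v \<Rightarrow>\<^sub>0 nat"
  shows "(\<Prod>v\<in>Poly_Mapping.keys (m + n). s v ^ Poly_Mapping.lookup (m + n) v) =
    (\<Prod>v\<in>Poly_Mapping.keys m. s v ^ Poly_Mapping.lookup m v) *
    (\<Prod>v\<in>Poly_Mapping.keys n. s v ^ Poly_Mapping.lookup n v)"
proof -
  let ?K = "Poly_Mapping.keys m \<union> Poly_Mapping.keys n"
  have widen: "(\<Prod>v\<in>Poly_Mapping.keys k. s v ^ Poly_Mapping.lookup k v) =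
      (\<Prod>v\<in>?K. s v ^ Poly_Mapping.lookup k v)"
    if "Poly_Mapping.keys k \<subseteq> ?K" for k
    using that by (intro prod.mono_neutral_left) (auto simp: in_keys_iff)
  show ?thesis
    unfolding widen[OF keys_add] widen[OF Un_upper1] widen[OF Un_upper2]
    by (simp add: lookup_add power_add prod.distrib)
qed

lemma monomial_degree_add:
  fixes m n :: "'v \<Rightarrow>\<^sub>0 nat"
  shows "(\<Sum>v\<in>Poly_Mapping.keys (m + n). Poly_Mapping.lookup (m + n) v) =
    (\<Sum>v\<in>Poly_Mapping.keys m. Poly_Mapping.lookup m v) +
    (\<Sum>v\<in>Poly_Mapping.keys n. Poly_Mapping.lookup n v)"
  by (rule setsum_keys_plus_distrib) simp_all

text \<open>An induction by adding terms: since products of terms are terms, this reduces multiplicativity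
  of evaluation to \<open>monomial_value_add\<close>.\<close>

lemma mpolynomial_induct [case_names zero single_add]:
  assumes "P 0" and "\<And>m c p. P p \<Longrightarrow> P (Poly_Mapping.single m c + p)"
  shows "P (p :: 'a \<Rightarrow>\<^sub>0 'b::monoid_add)"
proof (induction p rule: update_induct)
  case const
  show ?case by fact
next
  case (update f a b)
  have "Poly_Mapping.update a b f = Poly_Mapping.single a b + f"
    using update.hyps(1)
    by (intro poly_mapping_eqI) (auto simp: lookup_update lookup_add lookup_single in_keys_iff when_def)
  then show ?case using assms(2)[OF update.IH] by simp
qed

lemma eval_mpolynomial_zero: "eval_mpolynomial s 0 = 0"
  by (simp add: eval_mpolynomial_def)

lemma eval_mpolynomial_mult:
  "eval_mpolynomial s (p * q) = eval_mpolynomial s p * eval_mpolynomial s q"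
proof (induction p rule: mpolynomial_induct)
  case zero
  show ?case by (simp add: eval_mpolynomial_zero)
next
  case (single_add m c p)
  have "eval_mpolynomial s (Poly_Mapping.single m c * q) =
      eval_mpolynomial s (Poly_Mapping.single m c) * eval_mpolynomial s q"
  proof (induction q rule: mpolynomial_induct)
    case zero
    show ?case by (simp add: eval_mpolynomial_zero)
  next
    case (single_add n d q)
    then show ?case
      by (simp add: distrib_left mult_single eval_mpolynomial_add eval_mpolynomial_single
          monomial_value_add)
  qed
  with single_add show ?case
    by (simp add: distrib_right eval_mpolynomial_add)
qed

lemma homogeneous_of_degree_mult:
  assumes "homogeneous_of_degree k p" and "homogeneous_of_degree n q"
  shows "homogeneous_of_degree (k + n) (p * q)"
  unfolding homogeneous_of_degree_def
proof
  fix m assume "m \<in> Poly_Mapping.keys (p * q)"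
  then obtain m1 m2 where "m = m1 + m2" "m1 \<in> Poly_Mapping.keys p" "m2 \<in> Poly_Mapping.keys q"
    using keys_mult[of p q] by blast
  then show "(\<Sum>v\<in>Poly_Mapping.keys m. Poly_Mapping.lookup m v) = k + n"
    using assms by (simp add: homogeneous_of_degree_def monomial_degree_add)
qed

section \<open>Forms in the entries of two matrices\<close>

text \<open>The forms of a fixed degree, represented on all pairs of matrices and not just on traceless
  ones: with the degree in view, closure under sums and products can be stated.\<close>

definition entry_form :: "nat \<Rightarrow> ('f::field ^ 4 ^ 4 \<Rightarrow> 'f ^ 4 ^ 4 \<Rightarrow> 'f) \<Rightarrow> bool" where
  "entry_form n f \<longleftrightarrow> (\<exists>p. homogeneous_of_degree n p \<and>
     (\<forall>x y. f x y = eval_mpolynomial (pair_entries x y) p))"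

lemma entry_form_imp_form_on_sl4: "entry_form n f \<Longrightarrow> form_on_sl4 f"
  unfolding entry_form_def form_on_sl4_def by blast

lemma entry_form_add:
  assumes "entry_form n f" and "entry_form n g"
  shows "entry_form n (\<lambda>x y. f x y + g x y)"
proof -
  obtain p q where "homogeneous_of_degree n p" "homogeneous_of_degree n q"
    and "\<And>x y. f x y = eval_mpolynomial (pair_entries x y) p"
    and "\<And>x y. g x y = eval_mpolynomial (pair_entries x y) q"
    using assms unfolding entry_form_def by blast
  then show ?thesis
    unfolding entry_form_def using keys_add[of p q]
    by (intro exI[of _ "p + q"]) (auto simp: homogeneous_of_degree_def eval_mpolynomial_add)
qed

lemma entry_form_uminus:
  assumes "entry_form n f"
  shows "entry_form n (\<lambda>x y. - f x y)"
proof -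
  obtain p where "homogeneous_of_degree n p"
    and "\<And>x y. f x y = eval_mpolynomial (pair_entries x y) p"
    using assms unfolding entry_form_def by blast
  then show ?thesis
    unfolding entry_form_def
    by (intro exI[of _ "- p"]) (simp add: homogeneous_of_degree_def eval_mpolynomial_uminus)
qed

lemma entry_form_diff:
  assumes "entry_form n f" and "entry_form n g"
  shows "entry_form n (\<lambda>x y. f x y - g x y)"
  using entry_form_add[OF assms(1) entry_form_uminus[OF assms(2)]] by simp

lemma entry_form_mult:
  assumes "entry_form k f" and "entry_form n g"
  shows "entry_form (k + n) (\<lambda>x y. f x y * g x y)"
proof -
  obtain p q where "homogeneous_of_degree k p" "homogeneous_of_degree n q"
    and "\<And>x y. f x y = eval_mpolynomial (pair_entries x y) p"
    and "\<And>x y. g x y = eval_mpolynomial (pair_entries x y) q"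
    using assms unfolding entry_form_def by blast
  then show ?thesis
    unfolding entry_form_def
    by (intro exI[of _ "p * q"]) (simp add: homogeneous_of_degree_mult eval_mpolynomial_mult)
qed

lemma entry_form_entry:
  "entry_form 1 (\<lambda>x y. x $ i $ j)" "entry_form 1 (\<lambda>x y. y $ i $ j)"
proof -
  let ?var = "\<lambda>v. Poly_Mapping.single (Poly_Mapping.single v 1) 1"
  have "homogeneous_of_degree 1 (?var v)" for v
    by (simp add: homogeneous_of_degree_def)
  moreover have "x $ i $ j = eval_mpolynomial (pair_entries x y) (?var (Inl (i, j)))"
    "y $ i $ j = eval_mpolynomial (pair_entries x y) (?var (Inr (i, j)))" for x y
    by (simp_all add: eval_mpolynomial_single pair_entries_def)
  ultimately show "entry_form 1 (\<lambda>x y. x $ i $ j)" "entry_form 1 (\<lambda>x y. y $ i $ j)"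
    unfolding entry_form_def by metis+
qed

section \<open>Sums of principal minors\<close>

text \<open>A principal minor whose rows are taken from different matrices, one row from each. It is
  linear in each matrix, so the polarisation of the ordinary principal minor (all arguments equal to
  \<open>y\<close>) in the direction \<open>x\<close> is the sum of the values with one argument replaced by \<open>x\<close>.\<close>

definition mixed_minor2 :: "'r::comm_ring_1 ^ 4 ^ 4 \<Rightarrow> 'r ^ 4 ^ 4 \<Rightarrow> 4 \<Rightarrow> 4 \<Rightarrow> 'r" where
  "mixed_minor2 u v i j = u$i$i * v$j$j - u$i$j * v$j$i"

definition mixed_minor3 ::
    "'r::comm_ring_1 ^ 4 ^ 4 \<Rightarrow> 'r ^ 4 ^ 4 \<Rightarrow> 'r ^ 4 ^ 4 \<Rightarrow> 4 \<Rightarrow> 4 \<Rightarrow> 4 \<Rightarrow> 'r" where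
  "mixed_minor3 u v w i j k =
     u$i$i * (v$j$j * w$k$k - v$j$k * w$k$j)
   - u$i$j * (v$j$i * w$k$k - v$j$k * w$k$i)
   + u$i$k * (v$j$i * w$k$j - v$j$j * w$k$i)"

definition minor_sum2 :: "'r::comm_ring_1 ^ 4 ^ 4 \<Rightarrow> 'r ^ 4 ^ 4 \<Rightarrow> 'r" where
  "minor_sum2 u v = mixed_minor2 u v 1 2 + mixed_minor2 u v 1 3 + mixed_minor2 u v 1 4
     + mixed_minor2 u v 2 3 + mixed_minor2 u v 2 4 + mixed_minor2 u v 3 4"

definition minor_sum3 :: "'r::comm_ring_1 ^ 4 ^ 4 \<Rightarrow> 'r ^ 4 ^ 4 \<Rightarrow> 'r ^ 4 ^ 4 \<Rightarrow> 'r" where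
  "minor_sum3 u v w = mixed_minor3 u v w 1 2 3 + mixed_minor3 u v w 1 2 4
     + mixed_minor3 u v w 1 3 4 + mixed_minor3 u v w 2 3 4"

lemma entry_form_minor_sum2:
  assumes "\<And>i j. entry_form 1 (\<lambda>x y. u x y $ i $ j)" "\<And>i j. entry_form 1 (\<lambda>x y. v x y $ i $ j)"
  shows "entry_form 2 (\<lambda>x y. minor_sum2 (u x y) (v x y))"
proof -
  have m: "entry_form 2 (\<lambda>x y. u x y $ i $ j * v x y $ k $ l)" for i j k l
    using entry_form_mult[OF assms(1)[of i j] assms(2)[of k l]] by (simp add: numeral_2_eq_2)
  show ?thesis
    unfolding minor_sum2_def mixed_minor2_def
    by (intro entry_form_add entry_form_diff m)
qed

lemma entry_form_minor_sum3:
  assumes "\<And>i j. entry_form 1 (\<lambda>x y. u x y $ i $ j)" "\<And>i j. entry_form 1 (\<lambda>x y. v x y $ i $ j)"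
    "\<And>i j. entry_form 1 (\<lambda>x y. w x y $ i $ j)"
  shows "entry_form 3 (\<lambda>x y. minor_sum3 (u x y) (v x y) (w x y))"
proof -
  have m2: "entry_form 2 (\<lambda>x y. v x y $ i $ j * w x y $ k $ l)" for i j k l
    using entry_form_mult[OF assms(2)[of i j] assms(3)[of k l]] by (simp add: numeral_2_eq_2)
  have m3: "entry_form 3 (\<lambda>x y. u x y $ i $ j * f x y)" if "entry_form 2 f" for i j f
    using entry_form_mult[OF assms(1)[of i j] that] by (simp add: numeral_3_eq_3)
  show ?thesis
    unfolding minor_sum3_def mixed_minor3_def
    by (intro entry_form_add entry_form_diff m3 m2)
qed

section \<open>The Cayley--Hamilton theorem in size 4\<close>

text \<open>The Cayley--Hamilton equation is symmetric under renumbering of the indices. If all sums are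
  written in terms of an arbitrary enumeration \<open>i, j, k, l\<close> of the four indices, then the sixteen
  entries reduce to two polynomial identities, one off and one on the diagonal.\<close>

lemma sum_distinct_4:
  fixes f :: "4 \<Rightarrow> 'r::comm_monoid_add"
  assumes "distinct [i, j, k, l]"
  shows "sum f UNIV = f i + f j + f k + f l"
proof -
  have "card {i, j, k, l} = CARD(4)" using assms by simp
  then have "UNIV = {i, j, k, l}"
    by (metis card_subset_eq finite_class.finite_UNIV subset_UNIV)
  then have "sum f UNIV = sum f {i, j, k, l}" by (rule arg_cong)
  then show ?thesis using assms by (simp add: add.assoc)
qed

lemma minor_sum2_distinct:
  fixes y :: "'r::comm_ring_1 ^ 4 ^ 4"
  assumes "distinct [i, j, k, l]"
  shows "minor_sum2 y y = mixed_minor2 y y i j + mixed_minor2 y y i k + mixed_minor2 y y i l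
     + mixed_minor2 y y j k + mixed_minor2 y y j l + mixed_minor2 y y k l"
proof -
  have sym: "mixed_minor2 y y p q = mixed_minor2 y y q p" for p q
    by (simp add: mixed_minor2_def mult.commute)
  show ?thesis
    using assms exhaust_4[of i] exhaust_4[of j] exhaust_4[of k] exhaust_4[of l]
    unfolding minor_sum2_def
    by (elim disjE) (simp_all add: add_ac
        sym[of 2 1] sym[of 3 1] sym[of 4 1] sym[of 3 2] sym[of 4 2] sym[of 4 3])
qed

text \<open>Exchanging two indices permutes both the rows and the columns of a minor, so the sign
  cancels and every minor can be brought to increasing indices.\<close>

lemma minor_sum3_distinct:
  fixes y :: "'r::comm_ring_1 ^ 4 ^ 4"
  assumes "distinct [i, j, k, l]"
  shows "minor_sum3 y y y = mixed_minor3 y y y i j k + mixed_minor3 y y y i j l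
     + mixed_minor3 y y y i k l + mixed_minor3 y y y j k l"
proof -
  have sort: "mixed_minor3 y y y p r q = mixed_minor3 y y y p q r"
     "mixed_minor3 y y y q p r = mixed_minor3 y y y p q r"
     "mixed_minor3 y y y q r p = mixed_minor3 y y y p q r"
     "mixed_minor3 y y y r p q = mixed_minor3 y y y p q r"
     "mixed_minor3 y y y r q p = mixed_minor3 y y y p q r" for p q r
    by (simp_all add: mixed_minor3_def algebra_simps)
  show ?thesis
    using assms exhaust_4[of i] exhaust_4[of j] exhaust_4[of k] exhaust_4[of l]
    unfolding minor_sum3_def
    by (elim disjE) (simp_all add: add_ac
        sort[where p = 1 and q = 2 and r = 3] sort[where p = 1 and q = 2 and r = 4]
        sort[where p = 1 and q = 3 and r = 4] sort[where p = 2 and q = 3 and r = 4])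
qed

text \<open>The characteristic polynomial of \<open>y\<close> without its constant term, evaluated at \<open>y\<close>. The scalar
  factors are multiplied entry by entry because \<open>smult_matrix\<close> is confined to fields, while the
  theorem is needed over a polynomial ring.\<close>

definition char_poly_nonconstant :: "'r::comm_ring_1 ^ 4 ^ 4 \<Rightarrow> 'r ^ 4 ^ 4" where
  "char_poly_nonconstant y = (\<chi> i j. (y ** (y ** (y ** y))) $ i $ j - trace y * (y ** (y ** y)) $ i $ j
     + minor_sum2 y y * (y ** y) $ i $ j - minor_sum3 y y y * y $ i $ j)"

lemma cayley_hamilton_off_diagonal:
  fixes y :: "'r::comm_ring_1 ^ 4 ^ 4"
  assumes d: "distinct [i, j, k, l]"
  shows "char_poly_nonconstant y $ i $ j = 0"
  by (simp add: char_poly_nonconstant_def matrix_matrix_mult_def sum_distinct_4[OF d] trace_def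
      minor_sum2_distinct[OF d] minor_sum3_distinct[OF d] mixed_minor2_def mixed_minor3_def
      algebra_simps)

lemma cayley_hamilton_diagonal:
  fixes y :: "'r::comm_ring_1 ^ 4 ^ 4"
  assumes d: "distinct [i, j, k, l]"
  shows "char_poly_nonconstant y $ i $ i = char_poly_nonconstant y $ j $ j"
  by (simp add: char_poly_nonconstant_def matrix_matrix_mult_def sum_distinct_4[OF d] trace_def
      minor_sum2_distinct[OF d] minor_sum3_distinct[OF d] mixed_minor2_def mixed_minor3_def
      algebra_simps)

lemma ex_distinct_4:
  fixes i j :: 4
  assumes "i \<noteq> j"
  obtains k l where "distinct [i, j, k, l]"
proof -
  have "card (- {i, j}) = 2"
    using assms by (simp add: Compl_eq_Diff_UNIV card_Diff_subset)
  then obtain k l where "- {i, j} = {k, l}" "k \<noteq> l"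
    by (auto simp: card_2_iff)
  then have "distinct [i, j, k, l]" using assms by auto
  then show ?thesis by (rule that)
qed

theorem cayley_hamilton_4:
  fixes y :: "'r::comm_ring_1 ^ 4 ^ 4"
  obtains c where "char_poly_nonconstant y = mat c"
proof
  have diagonal: "char_poly_nonconstant y $ i $ i = char_poly_nonconstant y $ 1 $ 1" for i
    by (metis cayley_hamilton_diagonal ex_distinct_4)
  have off_diagonal: "char_poly_nonconstant y $ i $ j = 0" if "i \<noteq> j" for i j
    using that by (metis cayley_hamilton_off_diagonal ex_distinct_4)
  show "char_poly_nonconstant y = mat (char_poly_nonconstant y $ 1 $ 1)"
    using diagonal off_diagonal by (simp add: vec_eq_iff mat_def)
qed

section \<open>Polarisation\<close>

text \<open>Taking the constant coefficient is a ring homomorphism and taking the linear coefficient is a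
  derivation along it. Applying the derivation to an identity for the pencil \<open>y + t x\<close> differentiates
  the identity at \<open>y\<close> in the direction \<open>x\<close>, over any commutative ring.\<close>

definition const_part :: "'r::comm_ring_1 poly \<Rightarrow> 'r" where
  "const_part p = poly p 0"

definition linear_part :: "'r::comm_ring_1 poly \<Rightarrow> 'r" where
  "linear_part p = poly.coeff p 1"

lemma const_part_simps:
  "const_part (p + q) = const_part p + const_part q"
  "const_part (p - q) = const_part p - const_part q"
  "const_part (p * q) = const_part p * const_part q"
  "const_part (sum f A) = (\<Sum>i\<in>A. const_part (f i))"
  by (simp_all add: const_part_def poly_sum)

lemma linear_part_simps:
  "linear_part (p + q) = linear_part p + linear_part q"
  "linear_part (p - q) = linear_part p - linear_part q"
  "linear_part (p * q) = linear_part p * const_part q + const_part p * linear_part q"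
  "linear_part (sum f A) = (\<Sum>i\<in>A. linear_part (f i))"
  "linear_part 0 = 0"
  by (simp_all add: const_part_def linear_part_def coeff_sum coeff_mult poly_0_coeff_0 add.commute)

definition pencil :: "'r::comm_ring_1 ^ 4 ^ 4 \<Rightarrow> 'r ^ 4 ^ 4 \<Rightarrow> 'r poly ^ 4 ^ 4" where
  "pencil x y = (\<chi> i j. [:y $ i $ j, x $ i $ j:])"

lemma pencil_simps:
  "const_part (pencil x y $ i $ j) = y $ i $ j"
  "linear_part (pencil x y $ i $ j) = x $ i $ j"
  by (simp_all add: pencil_def const_part_def linear_part_def)

lemma map_matrix_pencil:
  "map_matrix const_part (pencil x y) = y"
  "map_matrix linear_part (pencil x y) = x"
  by (simp_all add: pencil_simps vec_eq_iff)

lemma map_matrix_const_part_mult: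
  "map_matrix const_part (A ** B) = map_matrix const_part A ** map_matrix const_part B"
  by (simp add: vec_eq_iff matrix_matrix_mult_def const_part_simps)

lemma map_matrix_linear_part_mult:
  "map_matrix linear_part (A ** B) =
    map_matrix linear_part A ** map_matrix const_part B
    + map_matrix const_part A ** map_matrix linear_part B"
  by (simp add: vec_eq_iff matrix_matrix_mult_def linear_part_simps sum.distrib)

lemma const_part_mult_entry:
  "const_part ((A ** B) $ i $ j) = (map_matrix const_part A ** map_matrix const_part B) $ i $ j"
  using arg_cong[OF map_matrix_const_part_mult[of A B], of "\<lambda>M. M $ i $ j"] by simp

lemma linear_part_mult_entry:
  "linear_part ((A ** B) $ i $ j) = (map_matrix linear_part A ** map_matrix const_part B) $ i $ j
    + (map_matrix const_part A ** map_matrix linear_part B) $ i $ j"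
  using arg_cong[OF map_matrix_linear_part_mult[of A B], of "\<lambda>M. M $ i $ j"] by simp

definition minor_sum2_polar :: "'r::comm_ring_1 ^ 4 ^ 4 \<Rightarrow> 'r ^ 4 ^ 4 \<Rightarrow> 'r" where
  "minor_sum2_polar x y = minor_sum2 x y + minor_sum2 y x"

definition minor_sum3_polar :: "'r::comm_ring_1 ^ 4 ^ 4 \<Rightarrow> 'r ^ 4 ^ 4 \<Rightarrow> 'r" where
  "minor_sum3_polar x y = minor_sum3 x y y + minor_sum3 y x y + minor_sum3 y y x"

lemma minor_sum_pencil:
  "const_part (minor_sum2 (pencil x y) (pencil x y)) = minor_sum2 y y"
  "linear_part (minor_sum2 (pencil x y) (pencil x y)) = minor_sum2_polar x y"
  "const_part (minor_sum3 (pencil x y) (pencil x y) (pencil x y)) = minor_sum3 y y y"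
  "linear_part (minor_sum3 (pencil x y) (pencil x y) (pencil x y)) = minor_sum3_polar x y"
  by (simp_all add: minor_sum2_def minor_sum3_def mixed_minor2_def mixed_minor3_def
      minor_sum2_polar_def minor_sum3_polar_def
      const_part_simps linear_part_simps pencil_simps) (simp_all add: algebra_simps)

lemma trace_pencil:
  "const_part (trace (pencil x y)) = trace y" "linear_part (trace (pencil x y)) = trace x"
  by (simp_all add: trace_def const_part_simps linear_part_simps pencil_simps)

text \<open>This is the coefficient of \<open>t\<close> in the Cayley--Hamilton equation for \<open>y + t x\<close>. The term with the
  trace contributes nothing, because both coefficients of the trace of the pencil vanish.\<close>

theorem polarised_cayley_hamilton:
  fixes x y :: "'f::field ^ 4 ^ 4"
  assumes "trace x = 0" "trace y = 0"
  shows "\<exists>c. x ** (y ** (y ** y)) + y ** (x ** (y ** y)) + y ** (y ** (x ** y)) + y ** (y ** (y ** x))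
    + smult_matrix (minor_sum2 y y) (x ** y + y ** x)
    + smult_matrix (minor_sum2_polar x y) (y ** y)
    - smult_matrix (minor_sum3 y y y) x - smult_matrix (minor_sum3_polar x y) y = mat c"
    (is "\<exists>c. ?L = mat c")
proof -
  obtain c where c: "char_poly_nonconstant (pencil x y) = mat c"
    by (rule cayley_hamilton_4)
  have "?L $ i $ j = linear_part (char_poly_nonconstant (pencil x y) $ i $ j)" for i j
    using assms
    by (simp add: char_poly_nonconstant_def const_part_simps linear_part_simps minor_sum_pencil
        trace_pencil linear_part_mult_entry const_part_mult_entry map_matrix_pencil
        map_matrix_linear_part_mult map_matrix_const_part_mult smult_matrix_def pencil_simps
        matrix_add_ldistrib algebra_simps)
  then have "?L = mat (linear_part c)"
    unfolding c by (simp add: vec_eq_iff mat_def linear_part_simps)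
  then show ?thesis by blast
qed

section \<open>Brackets in characteristic 2\<close>

lemma char_2_double:
  fixes u :: "'f::field ^ 4 ^ 4"
  assumes "CHAR('f) = 2"
  shows "u + u = 0"
proof -
  have "(2::'f) = 0" using of_nat_CHAR[where ?'a='f] unfolding assms by simp
  then have "a + a = 0" for a :: 'f by (metis mult_2 mult_zero_left)
  then show ?thesis by (simp add: vec_eq_iff)
qed

lemma lie_bracket_char_2:
  fixes u v :: "'f::field ^ 4 ^ 4"
  assumes "CHAR('f) = 2"
  shows "lie_bracket u v = u ** v + v ** u"
  using char_2_double[OF assms, of "v ** u"]
  by (simp add: lie_bracket_def diff_eq_eq add.assoc)

text \<open>Left and right multiplication by \<open>y\<close> commute, so the cube of their sum has the binomial
  coefficients 1, 3, 3, 1; modulo 2 each of them is 1.\<close>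

lemma triple_bracket_char_2:
  fixes x y :: "'f::field ^ 4 ^ 4"
  assumes "CHAR('f) = 2"
  shows "lie_bracket (lie_bracket (lie_bracket x y) y) y =
    x ** (y ** (y ** y)) + y ** (x ** (y ** y)) + y ** (y ** (x ** y)) + y ** (y ** (y ** x))"
proof -
  have cancel: "u + (u + v) = v" for u v :: "'f ^ 4 ^ 4"
    using char_2_double[OF assms, of u] by (simp add: add.assoc[symmetric])
  have distrib: "(u + v) ** y = u ** y + v ** y" for u v :: "'f ^ 4 ^ 4"
    by (simp add: vec_eq_iff matrix_matrix_mult_def distrib_right sum.distrib)
  show ?thesis
    by (simp add: lie_bracket_char_2[OF assms] matrix_add_ldistrib distrib
        matrix_mul_assoc[symmetric] ac_simps cancel)
qed

section \<open>The identity\<close>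

theorem proposition6p5:
  assumes "CHAR('f::field) = 2"
  shows "\<exists>a b c d :: 'f ^ 4 ^ 4 \<Rightarrow> 'f ^ 4 ^ 4 \<Rightarrow> 'f.
    form_on_sl4 a \<and> form_on_sl4 b \<and> form_on_sl4 c \<and> form_on_sl4 d \<and>
    (\<forall>x\<in>sl4. \<forall>y\<in>sl4.
       psl4_class (lie_bracket (lie_bracket (lie_bracket x y) y) y) =
       psl4_class (smult_matrix (a x y) x + smult_matrix (b x y) y
         + smult_matrix (c x y) (lie_bracket x y) + smult_matrix (d x y) (y ** y)))"
proof (intro exI conjI ballI)
  show "form_on_sl4 (\<lambda>x y :: 'f ^ 4 ^ 4. minor_sum3 y y y)"
    by (intro entry_form_imp_form_on_sl4[of 3] entry_form_minor_sum3 entry_form_entry)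
  show "form_on_sl4 (minor_sum3_polar :: 'f ^ 4 ^ 4 \<Rightarrow> _)"
    unfolding minor_sum3_polar_def
    by (intro entry_form_imp_form_on_sl4[of 3] entry_form_add entry_form_minor_sum3 entry_form_entry)
  show "form_on_sl4 (\<lambda>x y :: 'f ^ 4 ^ 4. minor_sum2 y y)"
    by (intro entry_form_imp_form_on_sl4[of 2] entry_form_minor_sum2 entry_form_entry)
  show "form_on_sl4 (minor_sum2_polar :: 'f ^ 4 ^ 4 \<Rightarrow> _)"
    unfolding minor_sum2_polar_def
    by (intro entry_form_imp_form_on_sl4[of 2] entry_form_add entry_form_minor_sum2 entry_form_entry)
next
  fix x y :: "'f ^ 4 ^ 4"
  assume "x \<in> sl4" "y \<in> sl4"
  then obtain c where c: "lie_bracket (lie_bracket (lie_bracket x y) y) y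
    + smult_matrix (minor_sum2 y y) (lie_bracket x y)
    + smult_matrix (minor_sum2_polar x y) (y ** y)
    - smult_matrix (minor_sum3 y y y) x - smult_matrix (minor_sum3_polar x y) y = mat c"
    using polarised_cayley_hamilton[of x y]
    unfolding triple_bracket_char_2[OF assms]
    unfolding lie_bracket_char_2[OF assms] sl4_def by blast
  (* Since signs may be dropped, the left-hand side of the equation above
     is the difference of the two sides of the goal. *)
  have neg: "- u = u" for u :: "'f ^ 4 ^ 4"
    using char_2_double[OF assms, of u] by (simp add: neg_eq_iff_add_eq_0)
  show "psl4_class (lie_bracket (lie_bracket (lie_bracket x y) y) y) =
       psl4_class (smult_matrix (minor_sum3 y y y) x + smult_matrix (minor_sum3_polar x y) y
         + smult_matrix (minor_sum2 y y) (lie_bracket x y)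
         + smult_matrix (minor_sum2_polar x y) (y ** y))"
    unfolding psl4_class_eq_iff
    using c by (intro exI[of _ c]) (simp add: diff_conv_add_uminus neg ac_simps del: add_uminus_conv_diff)
qed

end
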